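(* Let $\mathcal{C} \subseteq \mathcal{I}_{\mathrm{P}}$ and let $k_i \in \{1,\dots,K-1\}$ for each $i \in \mathcal{I}_{\mathrm{P}} \setminus \mathcal{C}$. Then the lifted subadditive inequality $$\eta \le 1 - p_{\mathcal{C}} + p_{\mathcal{C}} \left( \sum_{i \in \mathcal{I}_{\mathrm{P}} \setminus \mathcal{C}} h_{i,k_i}(y_i, z_i) + \sum_{i \in \mathcal{C}} p_i (y_i - z_i) + \sum_{i \in \mathcal{I}_{\mathrm{F}}} z_i \right)$$ is valid for $\operatorname{conv}(\mathcal{X})$, i.e. satisfied by every $(\eta,y,z) \in \operatorname{conv}(\mathcal{X})$.
   Context: $\mathcal{I}$ is a finite set, $K \ge 2$ is an integer, and $p_i \in [0,1]$ for each $i \in \mathcal{I}$. Put $\mathcal{I}_{\mathrm{P}} = \{i \in \mathcal{I} : 0 \le p_i < 1\}$ and $\mathcal{I}_{\mathrm{F}} = \{i \in \mathcal{I} : p_i = 1\}$. The convention $0^0 = 1$ is used. Define $$\mathcal{X} = \Big\{(\eta,y,z) \in \mathbb{R} \times \mathbb{Z}_{\ge 0}^{|\mathcal{I}|} \times \{0,1\}^{|\mathcal{I}|} : \eta \le 1 - \prod_{i \in \mathcal{I}} (1-p_i)^{y_i},\ z_i \le y_i \le K z_i \ \text{for all } i \in \mathcal{I}\Big\},$$ and let $\operatorname{conv}(\mathcal{X})$ be its convex hull. For $\mathcal{C} \subseteq \mathcal{I}_{\mathrm{P}}$, $p_{\mathcal{C}} := \prod_{i \in \mathcal{C}} (1-p_i)$,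 with $p_{\varnothing} := 1$. For $i \in \mathcal{I}_{\mathrm{P}}$ and $k \in \{1,\dots,K-1\}$, $$h_{i,k}(y_i,z_i) := p_i (1-p_i)^k y_i + \left(1 - (1-p_i)^k (k p_i + 1)\right) z_i .$$ *)

theory Defs
  imports "HOL-Analysis.Analysis"
begin

text \<open>The index set is a subset \<open>I\<close> of a finite type, so that it may be empty. The space
  \<open>\<real>\<^sup>I\<close> is the subspace of \<open>real ^ 'i\<close> in which all coordinates outside \<open>I\<close> vanish.\<close>

definition idxP :: "'i set \<Rightarrow> ('i \<Rightarrow> real) \<Rightarrow> 'i set" where
  "idxP I p = {i \<in> I. 0 \<le> p i \<and> p i < 1}"

definition idxF :: "'i set \<Rightarrow> ('i \<Rightarrow> real) \<Rightarrow> 'i set" where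
  "idxF I p = {i \<in> I. p i = 1}"

definition feasX :: "'i::finite set \<Rightarrow> nat \<Rightarrow> ('i \<Rightarrow> real) \<Rightarrow> (real \<times> (real ^ 'i) \<times> (real ^ 'i)) set" where
  "feasX I K p =
    {(\<eta>, (\<chi> i. real (y i)), (\<chi> i. real (z i))) | \<eta> (y :: 'i \<Rightarrow> nat) (z :: 'i \<Rightarrow> nat).
       \<eta> \<le> 1 - (\<Prod>i\<in>I. (1 - p i) ^ y i) \<and>
       (\<forall>i\<in>I. z i \<in> {0, 1} \<and> z i \<le> y i \<and> y i \<le> K * z i) \<and>
       (\<forall>i. i \<notin> I \<longrightarrow> y i = 0 \<and> z i = 0)}"

definition pprod :: "('i \<Rightarrow> real) \<Rightarrow> 'i set \<Rightarrow> real" where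
  "pprod p C = (\<Prod>i\<in>C. 1 - p i)"

definition hfun :: "('i \<Rightarrow> real) \<Rightarrow> 'i \<Rightarrow> nat \<Rightarrow> real \<Rightarrow> real \<Rightarrow> real" where
  "hfun p i k yi zi = p i * (1 - p i) ^ k * yi + (1 - (1 - p i) ^ k * (real k * p i + 1)) * zi"

end

theory Submission
  imports Defs
begin

text \<open>The inequality is linear, so it suffices to check it on \<open>feasX\<close> itself. Write
  \<open>q\<^sub>i = 1 - p\<^sub>i\<close> and let \<open>s\<^sub>i\<close> be the term of index \<open>i\<close> in the big bracket. After subtraction
  from \<open>1\<close>, the claim at a feasible point is \<open>p\<^sub>C (1 - \<Sum>i. s\<^sub>i) \<le> (\<Prod>i. q\<^sub>i ^ y\<^sub>i)\<close>.

  One power of \<open>q\<^sub>i\<close> is pulled out of the product for every \<open>i \<in> C\<close>, which accounts for the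
  factor \<open>p\<^sub>C\<close>: the remaining factors are \<open>r\<^sub>i = q\<^sub>i ^ (y\<^sub>i - z\<^sub>i)\<close> for \<open>i \<in> C\<close> and
  \<open>r\<^sub>i = q\<^sub>i ^ y\<^sub>i\<close> otherwise. An index \<open>i \<in> C\<close> with \<open>y\<^sub>i = 0\<close> has no power to give, but there
  \<open>1 \<ge> q\<^sub>i\<close> is enough. All \<open>r\<^sub>i\<close> lie in \<open>[0,1]\<close>, so Weierstrass' product inequality
  \<open>(\<Prod>i. r\<^sub>i) \<ge> 1 - (\<Sum>i. (1 - r\<^sub>i))\<close> reduces everything to \<open>1 - r\<^sub>i \<le> s\<^sub>i\<close> for each single \<open>i\<close>.

  For \<open>i \<in> C\<close> this is Bernoulli's inequality, and for \<open>p\<^sub>i = 1\<close> it is the convention \<open>0\<^sup>0 = 1\<close>.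
  In the remaining case the affine function \<open>y \<mapsto> h\<^bsub>i,k\<^esub>(y,1)\<close> agrees with the concave function
  \<open>1 - q\<^sub>i ^ y\<close> at \<open>y = k\<close> and \<open>y = k + 1\<close>; a chord through consecutive integers dominates a
  concave function at all other integers (\<open>power_ge_chord\<close>).\<close>

text \<open>The chord of \<open>n \<mapsto> q ^ n\<close> through \<open>k\<close> and \<open>k + 1\<close> lies below the sequence, by convexity.
  To the right of \<open>k\<close> this is Bernoulli's inequality for \<open>1 - p\<close>; to the left it follows from
  Bernoulli's inequality for \<open>1 + p\<close>, because \<open>(1 - p) ^ m * (1 + p) ^ m \<le> 1\<close>.\<close>

lemma power_ge_chord:
  fixes p :: real
  assumes "0 \<le> p" "p \<le> 1"
  shows "(1 - p) ^ k * (1 + (real k - real n) * p) \<le> (1 - p) ^ n"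
proof (cases "k \<le> n")
  case True
  then obtain m where n: "n = k + m"
    using le_Suc_ex by blast
  have "1 + (real k - real n) * p \<le> (1 - p) ^ m"
    using Bernoulli_inequality[of "- p" m] assms by (simp add: n)
  then show ?thesis
    using assms by (simp add: n power_add mult_left_mono)
next
  case False
  then obtain m where k: "k = n + m"
    using le_Suc_ex nat_le_linear by blast
  have "1 + (real k - real n) * p \<le> (1 + p) ^ m"
    using Bernoulli_inequality[of p m] assms by (simp add: k)
  then have "(1 - p) ^ m * (1 + (real k - real n) * p) \<le> (1 - p) ^ m * (1 + p) ^ m"
    using assms by (intro mult_left_mono) auto
  also have "\<dots> = (1 - p\<^sup>2) ^ m"
    by (simp add: power_mult_distrib[symmetric] algebra_simps power2_eq_square)
  also have "\<dots> \<le> 1"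
    using assms by (intro power_le_one) (auto simp: power_le_one)
  finally have "(1 - p) ^ n * ((1 - p) ^ m * (1 + (real k - real n) * p)) \<le> (1 - p) ^ n * 1"
    using assms by (intro mult_left_mono) auto
  then show ?thesis
    by (simp add: k power_add mult.assoc)
qed

lemma hfun_ge:
  assumes "0 \<le> p i" "p i \<le> 1" "z \<in> {0, 1}" "y \<le> K * z"
  shows "1 - (1 - p i) ^ y \<le> hfun p i k (real y) (real z)"
proof (cases "z = 0")
  case True
  then show ?thesis
    using assms by (simp add: hfun_def)
next
  case False
  then have "z = 1"
    using assms by simp
  then show ?thesis
    using power_ge_chord[of "p i" k y] assms by (simp add: hfun_def algebra_simps)
qed

lemma linear_le_on_convex_hull:
  fixes f :: "'a::real_vector \<Rightarrow> real"
  assumes "linear f" "\<And>x. x \<in> S \<Longrightarrow> f x \<le> c" "x \<in> convex hull S"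
  shows "f x \<le> c"
proof -
  have "convex hull S \<subseteq> f -` {..c}"
    using assms by (intro hull_minimal convex_linear_vimage) auto
  then show ?thesis
    using assms by auto
qed

lemma feasible_point_ineq:
  fixes I :: "'i::finite set" and y z :: "'i \<Rightarrow> nat"
  assumes p: "\<And>i. i \<in> I \<Longrightarrow> 0 \<le> p i \<and> p i \<le> 1"
    and C: "C \<subseteq> idxP I p"
    and yz: "\<And>i. i \<in> I \<Longrightarrow> z i \<in> {0, 1} \<and> z i \<le> y i \<and> y i \<le> K * z i"
  shows "1 - (\<Prod>i\<in>I. (1 - p i) ^ y i) \<le> 1 - pprod p C + pprod p C *
      ((\<Sum>i\<in>idxP I p - C. hfun p i (k i) (real (y i)) (real (z i)))
       + (\<Sum>i\<in>C. p i * (real (y i) - real (z i)))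
       + (\<Sum>i\<in>idxF I p. real (z i)))"
proof -
  define s where "s i = (if i \<in> C then p i * (real (y i) - real (z i))
      else if p i = 1 then real (z i) else hfun p i (k i) (real (y i)) (real (z i)))" for i
  define r where "r i = (1 - p i) ^ (if i \<in> C then y i - z i else y i)" for i
  have CI: "C \<subseteq> I"
    using C by (auto simp: idxP_def)
  have C1: "p i \<noteq> 1" if "i \<in> C" for i
    using C that by (auto simp: idxP_def)
  have I: "I = (idxP I p - C) \<union> C \<union> idxF I p"
    using p CI by (force simp: idxP_def idxF_def)
  have "sum s I = sum s (idxP I p - C) + sum s C + sum s (idxF I p)"
    using C by (subst I, subst sum.union_disjoint, simp, simp, force simp: idxP_def idxF_def,
      subst sum.union_disjoint) auto
  also have "sum s (idxP I p - C)
      = (\<Sum>i\<in>idxP I p - C. hfun p i (k i) (real (y i)) (real (z i)))"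
    by (rule sum.cong) (auto simp: s_def idxP_def)
  also have "sum s C = (\<Sum>i\<in>C. p i * (real (y i) - real (z i)))"
    by (rule sum.cong) (auto simp: s_def)
  also have "sum s (idxF I p) = (\<Sum>i\<in>idxF I p. real (z i))"
    using C1 by (intro sum.cong) (auto simp: s_def idxF_def)
  finally have sum_s: "sum s I =
      (\<Sum>i\<in>idxP I p - C. hfun p i (k i) (real (y i)) (real (z i)))
       + (\<Sum>i\<in>C. p i * (real (y i) - real (z i)))
       + (\<Sum>i\<in>idxF I p. real (z i))" .

  have r01: "r i \<in> {0..1}" if "i \<in> I" for i
    using p[OF that] by (auto simp: r_def power_le_one)
  have rs: "1 - r i \<le> s i" if i: "i \<in> I" for i
  proof -
    consider "i \<in> C" | "i \<notin> C" "p i = 1" | "i \<notin> C" "p i \<noteq> 1"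
      by blast
    then show ?thesis
    proof cases
      case 1
      then show ?thesis
        using Bernoulli_inequality[of "- p i" "y i - z i"] p[OF i] yz[OF i]
        by (simp add: r_def s_def of_nat_diff algebra_simps)
    next
      case 2
      then show ?thesis
        using yz[OF i] by (auto simp: r_def s_def power_0_left)
    next
      case 3
      then show ?thesis
        using hfun_ge[of p i "z i" "y i" K "k i"] p[OF i] yz[OF i] by (simp add: r_def s_def)
    qed
  qed
  have "1 - sum s I \<le> 1 - (\<Sum>i\<in>I. 1 - r i)"
    using rs by (simp add: sum_mono)
  also have "\<dots> \<le> (\<Prod>i\<in>I. 1 - (1 - r i))"
    using r01 by (intro Weierstrass_prod_ineq) auto
  finally have prod_r: "1 - sum s I \<le> prod r I"
    by simp

  have pC: "pprod p C = (\<Prod>i\<in>I. if i \<in> C then 1 - p i else 1)"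
    using CI by (simp add: pprod_def prod.If_cases Int_absorb1)
  have pC0: "0 \<le> pprod p C"
    unfolding pprod_def using p CI by (intro prod_nonneg) auto
  have "pprod p C * (1 - sum s I) \<le> pprod p C * prod r I"
    using prod_r pC0 by (rule mult_left_mono)
  also have "\<dots> = (\<Prod>i\<in>I. (if i \<in> C then 1 - p i else 1) * r i)"
    by (simp add: pC prod.distrib)
  also have "\<dots> \<le> (\<Prod>i\<in>I. (1 - p i) ^ y i)"
  proof (rule prod_mono)
    fix i assume i: "i \<in> I"
    have "(1 - p i) * (1 - p i) ^ (y i - z i) \<le> (1 - p i) ^ y i"
      \<comment> \<open>equality if \<open>z i = 1\<close>\<close>
      using p[OF i] yz[OF i] by (cases "y i") (auto simp: mult_left_le_one_le)
    then show "0 \<le> (if i \<in> C then 1 - p i else 1) * r i \<and>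
        (if i \<in> C then 1 - p i else 1) * r i \<le> (1 - p i) ^ y i"
      using p[OF i] by (simp add: r_def)
  qed
  finally show ?thesis
    using sum_s by (simp add: algebra_simps)
qed

theorem mainTheorem3:
  fixes I :: "'i::finite set" and K :: nat and p :: "'i \<Rightarrow> real"
    and C :: "'i set" and k :: "'i \<Rightarrow> nat"
  assumes "K \<ge> 2"
    and "\<And>i. i \<in> I \<Longrightarrow> 0 \<le> p i \<and> p i \<le> 1"
    and "C \<subseteq> idxP I p"
    and "\<And>i. i \<in> idxP I p - C \<Longrightarrow> k i \<in> {1..K - 1}"
  shows "\<forall>(\<eta>, y, z) \<in> convex hull (feasX I K p).
    \<eta> \<le> 1 - pprod p C + pprod p C *
      ((\<Sum>i\<in>idxP I p - C. hfun p i (k i) (y $ i) (z $ i))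
       + (\<Sum>i\<in>C. p i * (y $ i - z $ i))
       + (\<Sum>i\<in>idxF I p. z $ i))"
proof -
  define g :: "real ^ 'i \<Rightarrow> real ^ 'i \<Rightarrow> real" where
    "g y z = (\<Sum>i\<in>idxP I p - C. hfun p i (k i) (y $ i) (z $ i))
       + (\<Sum>i\<in>C. p i * (y $ i - z $ i))
       + (\<Sum>i\<in>idxF I p. z $ i)" for y z
  define f where "f = (\<lambda>(\<eta>, y, z). \<eta> - pprod p C * g y z)"
  have g_add: "g (y + y') (z + z') = g y z + g y' z'" for y y' z z'
    by (simp add: g_def hfun_def algebra_simps sum.distrib sum_subtractf)
  have g_scale: "g (c *\<^sub>R y) (c *\<^sub>R z) = c * g y z" for c y z
    by (simp add: g_def hfun_def algebra_simps sum.distrib sum_subtractf sum_distrib_left)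
  have "linear f"
    by (rule linearI) (auto simp: f_def g_add g_scale algebra_simps)
  moreover have "f x \<le> 1 - pprod p C" if x: "x \<in> feasX I K p" for x
  proof -
    obtain \<eta> and y z :: "'i \<Rightarrow> nat"
      where x_eq: "x = (\<eta>, (\<chi> i. real (y i)), (\<chi> i. real (z i)))"
        and \<eta>: "\<eta> \<le> 1 - (\<Prod>i\<in>I. (1 - p i) ^ y i)"
        and yz: "\<And>i. i \<in> I \<Longrightarrow> z i \<in> {0, 1} \<and> z i \<le> y i \<and> y i \<le> K * z i"
      using x unfolding feasX_def by blast
    show ?thesis
      using \<eta> feasible_point_ineq[of I p C z y K k, OF assms(2,3) yz]
      by (simp add: x_eq f_def g_def)
  qed
  ultimately have "f x \<le> 1 - pprod p C" if "x \<in> convex hull (feasX I K p)" for x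
    using linear_le_on_convex_hull that by blast
  then show ?thesis
    by (fastforce simp: f_def g_def)
qed

end
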